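(* Suppose that the sequences $F_m$, $m\in\mathbb N$, satisfy $\|F_m\|_{1,-2}\to0$ as $m\to\infty$. Then the Prime Number Theorem follows, in the form: $\zeta(s)\ne0$ for every $s\in\mathbb C\setminus\{1\}$ with $\Re(s)=1$.
   Context: $\mathbb N=\{1,2,3,\dots\}$, $\{x\}$ is the fractional part of $x$, and $\mu$ is the Möbius function. For $k\ge1$, $r_k(n)=k\left\{\frac nk\right\}$ for $n\in\mathbb N$ (so $r_1=0$), and $\mathbf 1$ is the constant sequence with value $1$. For $m\in\mathbb N$, $F_m$ is the sequence $$F_m=\mathbf 1+\Big(\sum_{k=2}^m r_k\frac{\mu(k)}{k}-r_m\sum_{k=1}^m\frac{\mu(k)}{k}\Big).$$ For a sequence $u=\{u(n)\}_{n\ge1}$, $\|u\|_{1,-2}=\sum_{n=1}^\infty|u(n)|\,n^{-2}$. $\zeta$ is the Riemann zeta function, analytically continued to $\mathbb C\setminus\{1\}$. The paper's formulation of the Prime Number Theorem is the statement that $\zeta(s)\neq0$ for all $s\in\mathbb C\setminus\{1\}$ with $\Re(s)=1$. *)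

theory Defs
  imports
    "HOL-Complex_Analysis.Complex_Analysis"
    "HOL-Computational_Algebra.Squarefree"
begin

section \<open>The sequences and the weighted norm\<close>

definition moebius :: "nat \<Rightarrow> int" where
  "moebius n = (if squarefree n then (-1) ^ card (prime_factors n) else 0)"

definition r_seq :: "nat \<Rightarrow> nat \<Rightarrow> real" where
  "r_seq k n = real k * frac (real n / real k)"

definition F_seq :: "nat \<Rightarrow> nat \<Rightarrow> real" where
  "F_seq m n = 1 + ((\<Sum>k = 2..m. r_seq k n * (real_of_int (moebius k) / real k))
                 - r_seq m n * (\<Sum>k = 1..m. real_of_int (moebius k) / real k))"

text \<open>
  Sequences are indexed by the positive integers, so a value \<open>u 0\<close> plays no role. The norm
  takes values in \<^typ>\<open>ennreal\<close>; it is \<open>\<infinity>\<close> for sequences outside the weighted space.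
\<close>
definition norm_1_m2 :: "(nat \<Rightarrow> real) \<Rightarrow> ennreal" where
  "norm_1_m2 u = (\<Sum>n. ennreal (\<bar>u (Suc n)\<bar> / real (Suc n) ^ 2))"


section \<open>The Riemann zeta function\<close>

text \<open>
  The analytic continuation of the Dirichlet series to the plane without \<open>1\<close>. It exists and
  is unique there (\<open>ex_zeta_continuation\<close>, \<open>zeta_continuation_unique\<close> below);
  its value at \<open>1\<close> is unspecified.
\<close>
definition is_zeta_continuation :: "(complex \<Rightarrow> complex) \<Rightarrow> bool" where
  "is_zeta_continuation f \<longleftrightarrow>
     f holomorphic_on (- {1}) \<and>
     (\<forall>s. Re s > 1 \<longrightarrow> f s = (\<Sum>n. of_nat (Suc n) powr (- s)))"

definition zeta :: "complex \<Rightarrow> complex" where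
  "zeta = (SOME f. is_zeta_continuation f)"

lemma zeta_continuation_unique:
  assumes "is_zeta_continuation f" "is_zeta_continuation g" "s \<noteq> 1"
  shows "f s = g s"
proof (rule analytic_continuation_open[of "{s. Re s > 1}" "- {1}" f g])
  show "open {s. Re s > 1}" by (rule open_halfspace_Re_gt)
  have "(2::complex) \<in> {s. Re s > 1}" by simp
  then show "{s. Re s > 1} \<noteq> {}" by blast
  show "connected (- {1 :: complex})"
    by (rule connected_punctured_universe) simp
qed (use assms in \<open>auto simp: is_zeta_continuation_def\<close>)

text \<open>
  Existence. Summing the binomial expansion of \<open>(n + 1) powr (1 - s) - n powr (1 - s)\<close>
  over \<open>n \<ge> 2\<close> expresses \<open>\<phi> s = (s - 1) * (\<zeta> s - 1)\<close> through
  \<open>\<phi> (s + 1), \<dots>, \<phi> (s + K)\<close> and a remainder series converging for \<open>Re s > - K\<close>,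
  which extends \<open>\<phi>\<close> to the left one strip at a time.
\<close>

lemma holomorphic_suminf:
  fixes f :: "nat \<Rightarrow> complex \<Rightarrow> complex"
  assumes S: "open S" and hol: "\<And>n. f n holomorphic_on S"
    and bd: "\<And>x. x \<in> S \<Longrightarrow> \<exists>d>0. cball x d \<subseteq> S \<and>
               (\<exists>M. summable M \<and> (\<forall>n. \<forall>y\<in>cball x d. norm (f n y) \<le> M n))"
  shows "(\<lambda>s. \<Sum>n. f n s) holomorphic_on S"
proof (rule holomorphic_uniform_sequence[OF S, where f = "\<lambda>n s. \<Sum>i<n. f i s"])
  show "(\<lambda>s. \<Sum>i<n. f i s) holomorphic_on S" for n
    by (intro holomorphic_intros hol)
  fix x assume "x \<in> S"
  from bd[OF this] obtain d M where d: "d > 0" "cball x d \<subseteq> S" "summable M"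
    and M: "\<And>n y. y \<in> cball x d \<Longrightarrow> norm (f n y) \<le> M n" by blast
  have "uniform_limit (cball x d) (\<lambda>n s. \<Sum>i<n. f i s) (\<lambda>s. \<Sum>n. f n s) sequentially"
    by (rule Weierstrass_m_test[OF M d(3)])
  with d show "\<exists>d>0. cball x d \<subseteq> S \<and>
      uniform_limit (cball x d) (\<lambda>n s. \<Sum>i<n. f i s) (\<lambda>s. \<Sum>n. f n s) sequentially"
    by blast
qed

lemma holomorphic_gbinomial:
  "f holomorphic_on S \<Longrightarrow> (\<lambda>s. f s gchoose k :: complex) holomorphic_on S"
  unfolding gbinomial_prod_rev by (intro holomorphic_intros) auto

lemma norm_gbinomial_le:
  fixes w :: complex
  assumes "norm w \<le> a"
  shows "norm (w gchoose j) \<le> (-1) ^ j * ((- a) gchoose j)"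
proof -
  have "norm (w gchoose j) = (\<Prod>i = 0..<j. norm (w - of_nat i)) / fact j"
    by (simp add: gbinomial_prod_rev norm_divide prod_norm)
  also have "\<dots> \<le> (\<Prod>i = 0..<j. a + real i) / fact j"
  proof (intro divide_right_mono prod_mono conjI)
    show "norm (w - of_nat i) \<le> a + real i" for i
      using norm_triangle_ineq4[of w "of_nat i"] assms by simp
  qed auto
  also have "(\<Prod>i = 0..<j. a + real i) = (-1) ^ j * (\<Prod>i = 0..<j. - a - real i)"
    by (induction j) (simp_all add: algebra_simps)
  finally show ?thesis by (simp add: gbinomial_prod_rev)
qed

lemma binomial_remainder_bound:
  fixes w :: complex and x a :: real
  assumes x: "0 \<le> x" "x \<le> 1/2" and a: "norm w \<le> a"
  shows "norm ((1 + of_real x) powr w - (\<Sum>j<K. (w gchoose j) * of_real x ^ j))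
           \<le> 2 powr a * (2 * x) ^ K"
proof -
  have s1: "(\<lambda>j. (w gchoose j) * of_real x ^ j) sums (1 + of_real x) powr w"
    by (rule gen_binomial_complex) (use x in auto)
  define c where "c j = (-1) ^ j * ((- a) gchoose j)" for j
  have c: "norm (w gchoose j) \<le> c j" for j
    using norm_gbinomial_le[OF a] by (simp add: c_def)
  have c0: "c j \<ge> 0" for j using c[of j] norm_ge_zero order_trans by blast
  have "(\<lambda>j. ((- a) gchoose j) * (- (1/2)) ^ j) sums (1 + - (1/2)) powr (- a)"
    by (rule gen_binomial_real) auto
  moreover have "((- a) gchoose j) * (- (1/2)) ^ j = c j * (1/2) ^ j" for j
    by (simp add: c_def power_minus[of "1/2"])
  moreover have "(1 + - (1/2)) powr (- a) = 2 powr a"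
    by (simp add: powr_minus powr_divide)
  ultimately have s2: "(\<lambda>j. c j * (1/2) ^ j) sums (2 powr a)" by simp
  have s3: "summable (\<lambda>j. c (j + K) * (1/2) ^ (j + K))"
    using s2 by (subst summable_iff_shift) (simp add: sums_iff)
  have "(\<lambda>j. (w gchoose (j + K)) * of_real x ^ (j + K)) sums
          ((1 + of_real x) powr w - (\<Sum>j<K. (w gchoose j) * of_real x ^ j))"
    using s1 by (rule sums_split_initial_segment)
  then have "norm ((1 + of_real x) powr w - (\<Sum>j<K. (w gchoose j) * of_real x ^ j))
      = norm (\<Sum>j. (w gchoose (j + K)) * of_real x ^ (j + K))" by (simp add: sums_iff)
  also have "\<dots> \<le> (\<Sum>j. (2 * x) ^ K * (c (j + K) * (1/2) ^ (j + K)))"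
  proof (rule norm_suminf_le)
    fix j
    have "norm ((w gchoose (j + K)) * of_real x ^ (j + K)) \<le> c (j + K) * x ^ (j + K)"
      using x by (auto simp: norm_mult norm_power intro!: mult_right_mono c)
    also have "x ^ (j + K) = x ^ K * x ^ j" by (simp add: power_add)
    also have "c (j + K) * (x ^ K * x ^ j) \<le> c (j + K) * (x ^ K * (1/2) ^ j)"
      using x by (intro mult_left_mono power_mono c0) auto
    also have "\<dots> = (2 * x) ^ K * (c (j + K) * (1/2) ^ (j + K))"
      by (simp add: power_add power_mult_distrib power_one_over field_simps)
    finally show "norm ((w gchoose (j + K)) * of_real x ^ (j + K))
        \<le> (2 * x) ^ K * (c (j + K) * (1/2) ^ (j + K))" .
  qed (intro summable_mult s3)
  also have "\<dots> = (2 * x) ^ K * (\<Sum>j. c (j + K) * (1/2) ^ (j + K))"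
    by (rule suminf_mult[OF s3])
  also have "\<dots> \<le> (2 * x) ^ K * 2 powr a"
  proof (rule mult_left_mono)
    have "(\<Sum>j. c j * (1/2) ^ j) = 2 powr a" using s2 by (simp add: sums_iff)
    then show "(\<Sum>j. c (j + K) * (1/2) ^ (j + K)) \<le> 2 powr a"
      using suminf_split_initial_segment[OF sums_summable[OF s2], of K]
        sum_nonneg[of "{..<K}" "\<lambda>j. c j * (1/2) ^ j"] c0 by simp
  qed (use x in simp)
  finally show ?thesis by (simp add: mult.commute)
qed

definition zeta_rem :: "nat \<Rightarrow> nat \<Rightarrow> complex \<Rightarrow> complex" where
  "zeta_rem K n s = of_nat (n + 3) powr (1 - s)
     - (\<Sum>j<K. ((1 - s) gchoose j) * of_nat (n + 2) powr (1 - s - of_nat j))"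

lemma zeta_rem_bound:
  assumes "norm (1 - s) \<le> a"
  shows "norm (zeta_rem K n s) \<le> 2 powr a * 2 ^ K * real (n + 2) powr (1 - Re s - real K)"
proof -
  define N where "N = real (n + 2)"
  have N: "N \<ge> 2" by (simp add: N_def)
  have cN: "(of_nat (n + 2) :: complex) = of_real N" by (simp add: N_def)
  have e: "(of_nat (n + 3) :: complex) = of_real N * (1 + of_real (1 / N))"
  proof -
    have "real (n + 3) = N * (1 + 1 / N)" using N by (simp add: N_def distrib_left)
    then have "complex_of_real (real (n + 3)) = of_real (N * (1 + 1 / N))" by (rule arg_cong)
    then show ?thesis by simp
  qed
  have p1: "(of_nat (n + 3) :: complex) powr (1 - s)
      = of_real N powr (1 - s) * (1 + of_real (1 / N)) powr (1 - s)"
  proof -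
    have "(1 + of_real (1 / N) :: complex) = of_real (1 + 1 / N)" by simp
    then show ?thesis unfolding e using N
      by (simp only:) (subst powr_times_real, auto)
  qed
  have p2: "of_nat (n + 2) powr (1 - s - of_nat j)
      = of_real N powr (1 - s) * of_real (1 / N) ^ j" for j
    unfolding cN using N
    by (subst powr_diff) (auto simp: powr_nat' field_simps power_divide)
  have "zeta_rem K n s = of_real N powr (1 - s) * ((1 + of_real (1 / N)) powr (1 - s)
      - (\<Sum>j<K. ((1 - s) gchoose j) * of_real (1 / N) ^ j))"
    unfolding zeta_rem_def p1 p2 by (simp add: right_diff_distrib sum_distrib_left mult_ac)
  then have "norm (zeta_rem K n s) \<le> norm (of_real N powr (1 - s) :: complex)
      * (2 powr a * (2 * (1 / N)) ^ K)"
    using N by (simp only: norm_mult) (intro mult_left_mono binomial_remainder_bound assms, auto)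
  also have "norm (of_real N powr (1 - s) :: complex) = N powr (1 - Re s)"
    using N by (simp add: norm_powr_real_powr)
  also have "N powr (1 - Re s) * (2 powr a * (2 * (1 / N)) ^ K)
      = 2 powr a * 2 ^ K * N powr (1 - Re s - real K)"
    using N by (simp add: powr_diff powr_realpow power_divide)
  finally show ?thesis by (simp add: N_def)
qed

lemma summable_shift_powr:
  "e < -1 \<Longrightarrow> summable (\<lambda>n. real (n + c) powr e)"
  using summable_iff_shift[of "\<lambda>n. real n powr e" c] by (simp add: summable_real_powr_iff)

lemma powr_bound_on_halfplane:
  assumes "\<sigma> \<le> Re s"
  shows "real (n + 2) powr (t - Re s) \<le> real (n + 2) powr (t - \<sigma>)"
  using assms by (intro powr_mono) auto

lemma holomorphic_zeta_rem:
  "(\<lambda>s. \<Sum>n. zeta_rem (Suc K) n s) holomorphic_on {s. Re s > 1 - real K}"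
proof (rule holomorphic_suminf)
  show "open {s. Re s > 1 - real K}" by (rule open_halfspace_Re_gt)
  show "zeta_rem (Suc K) n holomorphic_on {s. Re s > 1 - real K}" for n
    unfolding zeta_rem_def by (intro holomorphic_intros holomorphic_gbinomial)
  fix x assume "x \<in> {s. Re s > 1 - real K}"
  then have x: "Re x > 1 - real K" by simp
  define d where "d = (Re x - (1 - real K)) / 2"
  define M where "M n = 2 powr (norm (1 - x) + d) * 2 ^ Suc K *
    real (n + 2) powr (1 - real (Suc K) - (Re x - d))" for n
  have d: "d > 0" using x by (simp add: d_def)
  have re: "Re x - d \<le> Re y" if "y \<in> cball x d" for y
    using that abs_Re_le_cmod[of "x - y"] by (simp add: dist_norm)
  have "cball x d \<subseteq> {s. Re s > 1 - real K}"
  proof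
    fix y assume "y \<in> cball x d"
    from re[OF this] show "y \<in> {s. Re s > 1 - real K}" using x by (simp add: d_def field_simps)
  qed
  moreover have "summable M" unfolding M_def
    by (intro summable_mult summable_shift_powr) (use x in \<open>simp add: d_def field_simps\<close>)
  moreover have "norm (zeta_rem (Suc K) n y) \<le> M n" if y: "y \<in> cball x d" for n y
  proof -
    have "norm (1 - y) \<le> norm (1 - x) + d"
      using y norm_triangle_ineq[of "1 - x" "x - y"] by (simp add: dist_norm)
    from zeta_rem_bound[OF this, of "Suc K" n]
    show ?thesis
      using powr_bound_on_halfplane[OF re[OF y], of n "1 - real (Suc K)"]
      unfolding M_def by (elim order_trans) (auto simp: algebra_simps)
  qed
  ultimately show "\<exists>d>0. cball x d \<subseteq> {s. Re s > 1 - real K} \<and>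
     (\<exists>M. summable M \<and> (\<forall>n. \<forall>y\<in>cball x d. norm (zeta_rem (Suc K) n y) \<le> M n))"
    using d by blast
qed

definition zeta_tail :: "complex \<Rightarrow> complex" where
  "zeta_tail s = (\<Sum>n. of_nat (n + 2) powr (- s))"

lemma zeta_tail_sums:
  assumes "Re s > 1"
  shows "(\<lambda>n. of_nat (n + 2) powr (- s)) sums zeta_tail s"
proof -
  have n: "norm ((of_nat (n + 2) :: complex) powr (- s)) = real (n + 2) powr (- Re s)" for n
    using norm_powr_real_powr[of "of_nat (n + 2)" "- s"] by (simp del: of_nat_add)
  have "summable (\<lambda>n. (of_nat (n + 2) :: complex) powr (- s))"
    by (rule summable_norm_cancel)
       (unfold n, rule summable_shift_powr, use assms in simp)
  then show ?thesis unfolding zeta_tail_def by (rule summable_sums)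
qed

lemma zeta_series_eq_tail:
  assumes "Re s > 1"
  shows "(\<Sum>n. of_nat (Suc n) powr (- s)) = 1 + zeta_tail s"
proof -
  have "(\<lambda>n. (of_nat (Suc (Suc n)) :: complex) powr (- s)) sums zeta_tail s"
    using zeta_tail_sums[OF assms] by simp
  then have "(\<lambda>n. (of_nat (Suc n) :: complex) powr (- s)) sums
      (zeta_tail s + of_nat (Suc 0) powr (- s))"
    by (subst (asm) sums_Suc_iff)
  then show ?thesis by (simp add: sums_iff)
qed

lemma zeta_rem_identity:
  assumes s: "Re s > 1"
  shows "(s - 1) * zeta_tail s = 2 powr (1 - s)
     + (\<Sum>j = 2..<Suc (Suc K). ((1 - s) gchoose j) * zeta_tail (s + of_nat j - 1))
     + (\<Sum>n. zeta_rem (Suc (Suc K)) n s)"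
proof -
  let ?b = "\<lambda>j n. ((1 - s) gchoose j) * (of_nat (n + 2) :: complex) powr (1 - s - of_nat j)"
  have lim: "(\<lambda>n. (of_nat (n + 2) :: complex) powr (1 - s)) \<longlonglongrightarrow> 0"
  proof (rule tendsto_norm_zero_cancel)
    have n: "norm ((of_nat (n + 2) :: complex) powr (1 - s)) = real (n + 2) powr (1 - Re s)" for n
      using norm_powr_real_powr[of "of_nat (n + 2)" "1 - s"] by (simp del: of_nat_add)
    have "((\<lambda>n. real n powr (1 - Re s)) \<longlongrightarrow> 0) sequentially"
      using s by (intro tendsto_neg_powr filterlim_real_sequentially) auto
    from LIMSEQ_ignore_initial_segment[OF this, of 2]
    show "(\<lambda>n. norm ((of_nat (n + 2) :: complex) powr (1 - s))) \<longlonglongrightarrow> 0"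
      unfolding n .
  qed
  have tel: "(\<lambda>n. (of_nat (n + 3) :: complex) powr (1 - s) - of_nat (n + 2) powr (1 - s))
      sums (0 - 2 powr (1 - s))"
    using telescope_sums[OF lim] by (simp add: eval_nat_numeral add_ac)
  have sb: "?b j sums (((1 - s) gchoose j) * zeta_tail (s + of_nat j - 1))" if "j \<ge> 1" for j
  proof -
    have "Re (s + of_nat j - 1) > 1" using s that by simp
    from sums_mult[OF zeta_tail_sums[OF this]] show ?thesis
      by (simp add: algebra_simps)
  qed
  have "(\<lambda>n. \<Sum>j = 1..<Suc (Suc K). ?b j n) sums
      (\<Sum>j = 1..<Suc (Suc K). ((1 - s) gchoose j) * zeta_tail (s + of_nat j - 1))"
    by (intro sums_sum sb) auto
  from sums_diff[OF tel this]
  have sd: "(\<lambda>n. of_nat (n + 3) powr (1 - s) - of_nat (n + 2) powr (1 - s)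
          - (\<Sum>j = 1..<Suc (Suc K). ?b j n)) sums (0 - 2 powr (1 - s)
      - (\<Sum>j = 1..<Suc (Suc K). ((1 - s) gchoose j) * zeta_tail (s + of_nat j - 1)))" .
  have "zeta_rem (Suc (Suc K)) n s = of_nat (n + 3) powr (1 - s) - of_nat (n + 2) powr (1 - s)
          - (\<Sum>j = 1..<Suc (Suc K). ?b j n)" for n
    unfolding zeta_rem_def lessThan_atLeast0
    by (subst sum.atLeast_Suc_lessThan) auto
  with sd have "(\<lambda>n. zeta_rem (Suc (Suc K)) n s) sums (0 - 2 powr (1 - s)
      - (\<Sum>j = 1..<Suc (Suc K). ((1 - s) gchoose j) * zeta_tail (s + of_nat j - 1)))"
    by simp
  moreover have "(\<Sum>j = 1..<Suc (Suc K). ((1 - s) gchoose j) * zeta_tail (s + of_nat j - 1))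
     = (1 - s) * zeta_tail s
       + (\<Sum>j = 2..<Suc (Suc K). ((1 - s) gchoose j) * zeta_tail (s + of_nat j - 1))"
    by (subst sum.atLeast_Suc_lessThan) (auto simp: numeral_2_eq_2)
  ultimately have "(\<Sum>n. zeta_rem (Suc (Suc K)) n s) = 0 - 2 powr (1 - s) - ((1 - s) * zeta_tail s
       + (\<Sum>j = 2..<Suc (Suc K). ((1 - s) gchoose j) * zeta_tail (s + of_nat j - 1)))"
    by (simp only: sums_iff)
  then show ?thesis by (simp only: ring_distribs) simp
qed

lemma zeta_continuation_strip:
  "\<exists>\<phi>. \<phi> holomorphic_on {s. Re s > 1 - real K} \<and>
       (\<forall>s. Re s > 1 \<longrightarrow> \<phi> s = (s - 1) * zeta_tail s)"
proof (induction K)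
  case 0
  have "zeta_tail holomorphic_on {s. Re s > 1}"
    unfolding zeta_tail_def[abs_def]
  proof (rule holomorphic_suminf)
    show "open {s. Re s > 1}" by (rule open_halfspace_Re_gt)
    show "(\<lambda>s. of_nat (n + 2) powr (- s)) holomorphic_on {s. Re s > 1}" for n
      by (intro holomorphic_intros)
    fix x assume "x \<in> {s. Re s > 1}"
    then have x: "Re x > 1" by simp
    define d where "d = (Re x - 1) / 2"
    have d: "d > 0" using x by (simp add: d_def)
    have re: "Re x - d \<le> Re y" if "y \<in> cball x d" for y
      using that abs_Re_le_cmod[of "x - y"] by (simp add: dist_norm)
    have n: "norm ((of_nat (n + 2) :: complex) powr (- s)) = real (n + 2) powr (- Re s)" for n s
      using norm_powr_real_powr[of "of_nat (n + 2)" "- s"] by (simp del: of_nat_add)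
    have "cball x d \<subseteq> {s. Re s > 1}"
    proof
      fix y assume "y \<in> cball x d"
      from re[OF this] show "y \<in> {s. Re s > 1}" using x by (simp add: d_def field_simps)
    qed
    moreover have "summable (\<lambda>n. real (n + 2) powr (0 - (Re x - d)))"
      by (rule summable_shift_powr) (use x in \<open>simp add: d_def field_simps\<close>)
    moreover have "norm ((of_nat (n + 2) :: complex) powr (- y))
        \<le> real (n + 2) powr (0 - (Re x - d))" if "y \<in> cball x d" for n y
      using powr_bound_on_halfplane[OF re[OF that], of n 0] unfolding n by simp
    ultimately show "\<exists>d>0. cball x d \<subseteq> {s. Re s > 1} \<and> (\<exists>M. summable M \<and>
        (\<forall>n. \<forall>y\<in>cball x d. norm ((of_nat (n + 2) :: complex) powr (- y)) \<le> M n))"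
      using d by blast
  qed
  then have "(\<lambda>s. (s - 1) * zeta_tail s) holomorphic_on {s. Re s > 1 - real 0}"
    by (auto intro!: holomorphic_intros)
  then show ?case by blast
next
  case (Suc K)
  then obtain \<phi> where hol: "\<phi> holomorphic_on {s. Re s > 1 - real K}"
    and eq: "\<And>s. Re s > 1 \<Longrightarrow> \<phi> s = (s - 1) * zeta_tail s" by blast
  define \<psi> where "\<psi> s = 2 powr (1 - s)
     - (\<Sum>j = 2..<Suc (Suc K). ((1 - s) gchoose (j - 1)) / of_nat j * \<phi> (s + of_nat j - 1))
     + (\<Sum>n. zeta_rem (Suc (Suc K)) n s)" for s
  have "\<psi> holomorphic_on {s. Re s > 1 - real (Suc K)}"
    unfolding \<psi>_def
  proof (intro holomorphic_intros holomorphic_gbinomial holomorphic_zeta_rem)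
    fix j assume j: "j \<in> {2..<Suc (Suc K)}"
    then have "(\<phi> \<circ> (\<lambda>s. s + of_nat j - 1)) holomorphic_on {s. Re s > 1 - real (Suc K)}"
      by (intro holomorphic_on_compose_gen[OF _ hol] holomorphic_intros) auto
    then show "(\<lambda>s. \<phi> (s + of_nat j - 1)) holomorphic_on {s. Re s > 1 - real (Suc K)}"
      by (simp add: o_def)
  qed auto
  moreover have "\<psi> s = (s - 1) * zeta_tail s" if s: "Re s > 1" for s
  proof -
    have "((1 - s) gchoose j) * zeta_tail (s + of_nat j - 1)
        = - (((1 - s) gchoose (j - 1)) / of_nat j * \<phi> (s + of_nat j - 1))"
      if "j \<in> {2..<Suc (Suc K)}" for j
    proof -
      from that have "j = Suc (j - 1)" "j - 1 \<ge> 1" by auto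
      then obtain i where i: "j = Suc i" "i \<ge> 1" by blast
      have "of_nat j * ((1 - s) gchoose j) = ((1 - s) - of_nat i) * ((1 - s) gchoose i)"
        unfolding i(1) using gbinomial_mult_1[of "1 - s" i] by (simp add: algebra_simps)
      moreover have "(of_nat j :: complex) \<noteq> 0"
        unfolding of_nat_eq_0_iff i(1) by simp
      ultimately have "((1 - s) gchoose j) = ((1 - s) - of_nat i) * ((1 - s) gchoose i) / of_nat j"
        by (metis nonzero_mult_div_cancel_left)
      moreover have "(1 - s) - of_nat i = - (s + of_nat j - 2)" using i by simp
      ultimately have g: "((1 - s) gchoose j) = - (s + of_nat j - 2) * ((1 - s) gchoose i) / of_nat j"
        by (simp only:)
      have "Re (s + of_nat j - 1) > 1" using s i by simp
      then have "\<phi> (s + of_nat j - 1) = (s + of_nat j - 1 - 1) * zeta_tail (s + of_nat j - 1)"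
        by (rule eq)
      also have "s + of_nat j - 1 - 1 = s + of_nat j - 2" by simp
      finally have p: "\<phi> (s + of_nat j - 1) = (s + of_nat j - 2) * zeta_tail (s + of_nat j - 1)" .
      have i_eq: "j - 1 = i" using i by simp
      have "- x * c / d * z = - (c / d * (x * z))" for x c d z :: complex by simp
      then show ?thesis unfolding g p i_eq .
    qed
    then show ?thesis
      unfolding zeta_rem_identity[OF s, of K] \<psi>_def by (simp add: sum_negf)
  qed
  ultimately show ?case by blast
qed

theorem ex_zeta_continuation: "\<exists>f. is_zeta_continuation f"
proof -
  define H where "H K = {s. Re s > 1 - real K}" for K
  obtain \<phi> where hol: "\<And>K. \<phi> K holomorphic_on H K"
    and eq: "\<And>K s. Re s > 1 \<Longrightarrow> \<phi> K s = (s - 1) * zeta_tail s"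
    using zeta_continuation_strip unfolding H_def by metis
  have op: "open (H K)" for K unfolding H_def by (rule open_halfspace_Re_gt)
  have sub: "H K \<subseteq> H L" if "K \<le> L" for K L using that by (auto simp: H_def)
  have agree: "\<phi> K s = \<phi> L s" if KL: "K \<le> L" and s: "s \<in> H K" for K L s
  proof (rule analytic_continuation_open[of "H 0" "H K" "\<phi> K" "\<phi> L"])
    have "(2::complex) \<in> H 0" by (simp add: H_def)
    then show "H 0 \<noteq> {}" by blast
    show "connected (H K)"
      unfolding H_def by (intro convex_connected convex_halfspace_Re_gt)
    show "\<phi> L holomorphic_on H K" using hol sub[OF KL] holomorphic_on_subset by blast
    show "open (H 0)" "open (H K)" "H 0 \<subseteq> H K" by (intro op sub le0)+
    show "\<phi> K holomorphic_on H K" "s \<in> H K" by (fact hol s)+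
  qed (auto simp: H_def eq)
  define \<kappa> where "\<kappa> s = nat \<lceil>2 - Re s\<rceil>" for s
  have \<kappa>: "s \<in> H (\<kappa> s)" for s
  proof -
    have "2 - Re s \<le> real (\<kappa> s)" unfolding \<kappa>_def by (rule real_nat_ceiling_ge)
    then show ?thesis by (simp add: H_def)
  qed
  define \<Phi> where "\<Phi> s = \<phi> (\<kappa> s) s" for s
  have \<Phi>: "\<Phi> s = \<phi> K s" if "s \<in> H K" for s K
    unfolding \<Phi>_def using agree[of K "\<kappa> s" s] agree[of "\<kappa> s" K s] \<kappa>[of s] that
    by (metis nat_le_linear)
  have "\<Phi> holomorphic_on (\<Union>K. H K)"
  proof (rule holomorphic_on_UN_open)
    show "\<Phi> holomorphic_on H K" for K
      by (rule holomorphic_transform[OF hol]) (use \<Phi> in auto)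
  qed (use op in auto)
  then have \<Phi>_hol: "\<Phi> holomorphic_on (- {1})"
    by (rule holomorphic_on_subset) (use \<kappa> in auto)
  have "is_zeta_continuation (\<lambda>s. 1 + \<Phi> s / (s - 1))"
    unfolding is_zeta_continuation_def
  proof (intro conjI allI impI)
    show "(\<lambda>s. 1 + \<Phi> s / (s - 1)) holomorphic_on (- {1})"
      by (intro holomorphic_intros \<Phi>_hol) auto
    fix s :: complex assume s: "Re s > 1"
    then have "s \<in> H 0" "s \<noteq> 1" by (auto simp: H_def)
    then show "1 + \<Phi> s / (s - 1) = (\<Sum>n. of_nat (Suc n) powr (- s))"
      using \<Phi>[of s 0] eq[OF s, of 0] zeta_series_eq_tail[OF s] by simp
  qed
  then show ?thesis by blast
qed

lemma is_zeta_continuation_zeta: "is_zeta_continuation zeta"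
  unfolding zeta_def using ex_zeta_continuation by (rule someI_ex)

end

theory Submission
  imports Defs
begin

text \<open>
  The proof is a duality argument. For \<open>Re s = 1\<close> the weights \<open>n powr (-s) - (n + 1) powr (-s)\<close>
  are at most \<open>norm s / n^2\<close> in absolute value, so

    \<open>L\<^sub>s u = (\<Sum>n\<ge>1. u n * (n powr (-s) - (n + 1) powr (-s)))\<close>

  is a continuous linear functional for the norm in question
  (\<open>zeta_weight_bound\<close>). Summation by parts turns \<open>L\<^sub>s u\<close> into the Dirichlet series of the
  increments of \<open>u\<close>. The constant sequence has its only increment at \<open>1\<close>, so \<open>L\<^sub>s\<close>
  maps it to \<open>1\<close>. The sequence \<open>r\<^sub>k\<close> grows by \<open>1\<close> at each step and drops by an extra \<open>k\<close> at
  the multiples of \<open>k\<close>, so \<open>L\<^sub>s r\<^sub>k = \<zeta> s * (1 - k powr (1 - s))\<close>, first for \<open>Re s > 1\<close> and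
  then, because \<open>r\<^sub>k\<close> is bounded, by analytic continuation for \<open>Re s > 0\<close>
  (\<open>r_seq_transform\<close>).

  If now \<open>\<zeta> s = 0\<close> with \<open>Re s = 1\<close>, then \<open>L\<^sub>s\<close> annihilates every \<open>r\<^sub>k\<close>. Since \<open>F\<^sub>m\<close> is the
  constant \<open>1\<close> plus a combination of the \<open>r\<^sub>k\<close>, this gives \<open>L\<^sub>s F\<^sub>m = 1\<close> for all \<open>m\<close>, and
  the norm of \<open>F\<^sub>m\<close> is at least \<open>1 / norm s\<close>: the constant sequence keeps a positive distance
  from the span of the \<open>r\<^sub>k\<close>, and \<open>F\<^sub>m\<close> cannot tend to \<open>0\<close>.
\<close>

definition zeta_weight :: "complex \<Rightarrow> nat \<Rightarrow> complex" where
  "zeta_weight s n = of_nat n powr (- s) - of_nat (Suc n) powr (- s)"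

text \<open>
  Mean value inequality for \<open>z powr (- s)\<close> on the real segment from \<open>n\<close> to \<open>n + 1\<close>, where the
  derivative is largest in modulus at \<open>n\<close>.
\<close>
lemma zeta_weight_bound:
  assumes "0 \<le> Re s + 1" "n > 0"
  shows "norm (zeta_weight s n) \<le> norm s * real n powr (- Re s - 1)"
proof -
  let ?S = "closed_segment (complex_of_real (real n)) (complex_of_real (real (Suc n)))"
  have S: "\<exists>x. z = of_real x \<and> real n \<le> x" if "z \<in> ?S" for z
    using that unfolding closed_segment_of_real
    by (auto simp: closed_segment_eq_real_ivl)
  have "norm (complex_of_real (real n) powr (- s) - complex_of_real (real (Suc n)) powr (- s))
      \<le> (norm s * real n powr (- Re s - 1)) *
         norm (complex_of_real (real n) - complex_of_real (real (Suc n)))"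
  proof (rule field_differentiable_bound[where S = ?S and f' = "\<lambda>z. - s * z powr (- s - 1)"])
    fix z assume "z \<in> ?S"
    then obtain x where x: "z = of_real x" "real n \<le> x" using S by blast
    then have "z \<notin> \<real>\<^sub>\<le>\<^sub>0" using assms by (auto simp: complex_nonpos_Reals_iff)
    then show "((\<lambda>z. z powr (- s)) has_field_derivative - s * z powr (- s - 1)) (at z within ?S)"
      by (rule has_field_derivative_at_within[OF has_field_derivative_powr])
    have "norm (z powr (- s - 1)) = x powr (- Re s - 1)"
      using x assms by (simp add: norm_powr_real_powr)
    also have "\<dots> \<le> real n powr (- Re s - 1)"
      by (rule powr_mono2') (use assms x in auto)
    finally show "norm (- s * z powr (- s - 1)) \<le> norm s * real n powr (- Re s - 1)"
      by (simp add: norm_mult mult_left_mono)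
  qed auto
  moreover have "norm (complex_of_real (real n) - complex_of_real (real (Suc n))) = 1"
    by simp
  ultimately show ?thesis
    by (simp add: zeta_weight_def del: of_nat_Suc)
qed

lemma r_seq_eq_mod:
  assumes "k > 0"
  shows "r_seq k n = real (n mod k)"
proof -
  have "real n = real (k * (n div k) + n mod k)" by simp
  also have "\<dots> = real k * real (n div k) + real (n mod k)"
    by (simp only: of_nat_add of_nat_mult)
  finally have "real n / real k - real (n mod k) / real k = of_int (int (n div k))"
    using assms by (simp add: field_simps)
  then have "frac (real n / real k) = real (n mod k) / real k"
    unfolding frac_unique_iff using assms by (metis Ints_of_int divide_less_eq_1_pos
        mod_less_divisor neq0_conv of_nat_0_le_iff of_nat_0_less_iff of_nat_less_iff divide_nonneg_nonneg)
  then show ?thesis using assms by (simp add: r_seq_def)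
qed

lemma r_seq_bounds: "0 \<le> r_seq k n" "r_seq k n \<le> real k"
  by (auto simp: r_seq_def intro!: mult_left_le less_imp_le[OF frac_lt_1])

lemma r_seq_increment:
  assumes "k > 0"
  shows "r_seq k (Suc n) - r_seq k n = 1 - (if k dvd Suc n then real k else 0)"
  using assms by (auto simp: r_seq_eq_mod mod_Suc dvd_eq_mod_eq_0 split: if_splits)

lemma zeta_sums:
  assumes "Re s > 1"
  shows "(\<lambda>n. of_nat (Suc n) powr (- s)) sums zeta s"
proof -
  have "summable (\<lambda>n. of_nat (Suc (Suc n)) powr (- s))"
    using zeta_tail_sums[OF assms] by (simp add: sums_iff)
  then have "summable (\<lambda>n. of_nat (Suc n) powr (- s))"
    by (subst (asm) summable_Suc_iff)
  moreover have "zeta s = (\<Sum>n. of_nat (Suc n) powr (- s))"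
    using is_zeta_continuation_zeta assms unfolding is_zeta_continuation_def by blast
  ultimately show ?thesis by (simp only: summable_sums)
qed

lemma zeta_multiples_sums:
  assumes "Re s > 1" "k > 0"
  shows "(\<lambda>n. if k dvd Suc n then of_nat (Suc n) powr (- s) else 0)
           sums (of_nat k powr (- s) * zeta s)"
    (is "?f sums _")
proof -
  define g where "g j = k * Suc j - 1" for j
  have g: "Suc (g j) = k * Suc j" for j using assms by (simp add: g_def)
  have "strict_mono g"
    unfolding strict_mono_Suc_iff using assms g by (metis Suc_less_eq lessI mult_less_cancel1)
  moreover have "?f n = 0" if "n \<notin> range g" for n
  proof -
    have "\<not> k dvd Suc n"
    proof
      assume "k dvd Suc n"
      then obtain j where j: "Suc n = k * j" by (auto elim: dvdE)
      then obtain i where "j = Suc i" by (cases j) auto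
      with j g[of i] have "n = g i" by simp
      with that show False by blast
    qed
    then show ?thesis by simp
  qed
  moreover have "?f (g j) = of_nat k powr (- s) * of_nat (Suc j) powr (- s)" for j
  proof -
    have "?f (g j) = (of_real (real k) * of_real (real (Suc j))) powr (- s)"
      unfolding g using assms by (simp del: of_nat_Suc mult_Suc_right)
    also have "\<dots> = of_real (real k) powr (- s) * of_real (real (Suc j)) powr (- s)"
      by (rule powr_times_real) auto
    finally show ?thesis by (simp del: of_nat_Suc)
  qed
  then have "(\<lambda>j. ?f (g j)) sums (of_nat k powr (- s) * zeta s)"
    by (simp only: sums_mult[OF zeta_sums[OF assms(1)]])
  ultimately show ?thesis by (subst (asm) sums_mono_reindex)
qed

text \<open>
  Summation by parts: for \<open>Re s > 1\<close> the two halves of the weight can be summed separately, and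
  collecting the terms with the same power leaves the increments of \<open>r_seq k\<close>.
\<close>
lemma r_seq_transform_halfplane:
  assumes s: "Re s > 1" and k: "k > 0"
  shows "(\<lambda>n. of_real (r_seq k (Suc n)) * zeta_weight s (Suc n))
           sums (zeta s * (1 - of_nat k powr (1 - s)))"
proof -
  define p where "p n = of_nat n powr (- s)" for n :: nat
  have norm_p: "norm (p (Suc n)) = real (Suc n) powr (- Re s)" for n
    using norm_powr_real_powr[of "of_nat (Suc n)" "- s"] by (simp add: p_def del: of_nat_Suc)
  have summ: "summable (\<lambda>n. of_real (r_seq k (f n)) * p (Suc n))" for f
  proof (rule summable_comparison_test')
    show "summable (\<lambda>n. real k * real (n + 1) powr (- Re s))"
      by (intro summable_mult summable_shift_powr) (use s in simp)
    show "norm (of_real (r_seq k (f n)) * p (Suc n)) \<le> real k * real (n + 1) powr (- Re s)" for n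
      using r_seq_bounds[of k "f n"] by (auto simp: norm_mult norm_p intro!: mult_right_mono)
  qed
  define A where "A = (\<Sum>n. of_real (r_seq k (Suc n)) * p (Suc n))"
  define B where "B = (\<Sum>n. of_real (r_seq k n) * p (Suc n))"
  have A: "(\<lambda>n. of_real (r_seq k (Suc n)) * p (Suc n)) sums A"
    unfolding A_def by (rule summable_sums[OF summ])
  have B: "(\<lambda>n. of_real (r_seq k n) * p (Suc n)) sums B"
    unfolding B_def by (rule summable_sums[OF summ])
  have B': "(\<lambda>n. of_real (r_seq k (Suc n)) * p (Suc (Suc n))) sums B"
    using B by (subst sums_Suc_iff) (simp add: r_seq_def)
  have "(\<lambda>n. p (Suc n) - of_nat k * (if k dvd Suc n then p (Suc n) else 0))
          sums (zeta s - of_nat k * (of_nat k powr (- s) * zeta s))"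
    unfolding p_def by (intro sums_diff sums_mult zeta_sums zeta_multiples_sums s k)
  moreover have "p (Suc n) - of_nat k * (if k dvd Suc n then p (Suc n) else 0)
      = of_real (r_seq k (Suc n)) * p (Suc n) - of_real (r_seq k n) * p (Suc n)" for n
  proof -
    have "of_real (r_seq k (Suc n)) * p (Suc n) - of_real (r_seq k n) * p (Suc n)
        = of_real (r_seq k (Suc n) - r_seq k n) * p (Suc n)"
      by (simp add: algebra_simps)
    then show ?thesis
      unfolding r_seq_increment[OF k] by (cases "k dvd Suc n") (simp_all add: algebra_simps)
  qed
  ultimately have "zeta s - of_nat k * (of_nat k powr (- s) * zeta s) = A - B"
    using sums_unique2[OF _ sums_diff[OF A B]] by simp
  moreover have "of_nat k * (of_nat k powr (- s)) = (of_nat k powr (1 - s) :: complex)"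
    using k by (simp add: powr_diff powr_minus field_simps)
  ultimately have "A - B = zeta s * (1 - of_nat k powr (1 - s))"
    by (metis (no_types, lifting) mult.assoc mult.commute mult.right_neutral right_diff_distrib')
  with sums_diff[OF A B'] show ?thesis
    by (simp add: zeta_weight_def p_def right_diff_distrib del: of_nat_Suc)
qed

lemma bounded_zeta_weight_summable:
  assumes "Re s > 0" "\<And>n. norm (u n) \<le> C"
  shows "summable (\<lambda>n. u n * zeta_weight s (Suc n))"
proof (rule summable_comparison_test')
  show "summable (\<lambda>n. C * (norm s * real (n + 1) powr (- Re s - 1)))"
    by (intro summable_mult summable_shift_powr) (use assms in simp)
  have "C \<ge> 0" using assms(2)[of 0] norm_ge_zero order_trans by blast
  then show "norm (u n * zeta_weight s (Suc n)) \<le> C * (norm s * real (n + 1) powr (- Re s - 1))"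
    for n
    unfolding norm_mult using zeta_weight_bound[of s "Suc n"] assms
    by (intro mult_mono) auto
qed

lemma r_seq_transform_holomorphic:
  "(\<lambda>s. \<Sum>n. of_real (r_seq k (Suc n)) * zeta_weight s (Suc n)) holomorphic_on {s. Re s > 0}"
proof (rule holomorphic_suminf)
  show "open {s. Re s > 0}" by (rule open_halfspace_Re_gt)
  show "(\<lambda>s. of_real (r_seq k (Suc n)) * zeta_weight s (Suc n)) holomorphic_on {s. Re s > 0}" for n
    unfolding zeta_weight_def by (intro holomorphic_intros)
  fix x assume "x \<in> {s. Re s > 0}"
  then have x: "Re x > 0" by simp
  define d where "d = Re x / 2"
  define M where "M n = real k * ((norm x + d) * real (n + 1) powr (- d - 1))" for n
  have d: "d > 0" using x by (simp add: d_def)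
  have re: "d \<le> Re y" if "y \<in> cball x d" for y
    using that abs_Re_le_cmod[of "x - y"] by (simp add: dist_norm d_def)
  have "cball x d \<subseteq> {s. Re s > 0}" using re d by fastforce
  moreover have "summable M" unfolding M_def
    by (intro summable_mult summable_shift_powr) (use d in simp)
  moreover have "norm (of_real (r_seq k (Suc n)) * zeta_weight y (Suc n)) \<le> M n"
    if y: "y \<in> cball x d" for n y
  proof -
    have ny: "norm y \<le> norm x + d"
      using y norm_triangle_ineq4[of x "x - y"] by (simp add: dist_norm)
    have "norm (zeta_weight y (Suc n)) \<le> norm y * real (Suc n) powr (- Re y - 1)"
      by (rule zeta_weight_bound) (use re[OF y] d in auto)
    also have "\<dots> \<le> (norm x + d) * real (Suc n) powr (- d - 1)"
      using re[OF y] d by (intro mult_mono ny powr_mono) auto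
    finally show ?thesis
      unfolding norm_mult M_def using r_seq_bounds[of k "Suc n"] by (intro mult_mono) auto
  qed
  ultimately show "\<exists>d>0. cball x d \<subseteq> {s. Re s > 0} \<and> (\<exists>M. summable M \<and>
      (\<forall>n. \<forall>y\<in>cball x d. norm (of_real (r_seq k (Suc n)) * zeta_weight y (Suc n)) \<le> M n))"
    using d by blast
qed

text \<open>
  Both sides are holomorphic on the right half-plane without \<open>1\<close>: the series because \<open>r_seq k\<close> is
  bounded and the weights are of order \<open>n powr (- Re s - 1)\<close>. So the identity extends from
  \<open>Re s > 1\<close>.
\<close>
theorem r_seq_transform:
  assumes s: "Re s > 0" "s \<noteq> 1" and k: "k > 0"
  shows "(\<lambda>n. of_real (r_seq k (Suc n)) * zeta_weight s (Suc n))
           sums (zeta s * (1 - of_nat k powr (1 - s)))"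
proof -
  have "(\<Sum>n. of_real (r_seq k (Suc n)) * zeta_weight s (Suc n))
      = zeta s * (1 - of_nat k powr (1 - s))"
  proof (rule analytic_continuation_open[of "{s. Re s > 1}" "{s. Re s > 0} - {1}"
        "\<lambda>s. \<Sum>n. of_real (r_seq k (Suc n)) * zeta_weight s (Suc n)"
        "\<lambda>s. zeta s * (1 - of_nat k powr (1 - s))"])
    show "open {s. Re s > 1}" by (rule open_halfspace_Re_gt)
    have op: "open {s. Re s > 0}" by (rule open_halfspace_Re_gt)
    then show "open ({s. Re s > 0} - {1})" by (intro open_delete)
    have "(2::complex) \<in> {s. Re s > 1}" by simp
    then show "{s. Re s > 1} \<noteq> {}" by blast
    show "connected ({s. Re s > 0} - {1})"
      by (intro connected_open_delete op convex_connected convex_halfspace_Re_gt) simp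
    show "(\<lambda>s. \<Sum>n. of_real (r_seq k (Suc n)) * zeta_weight s (Suc n))
        holomorphic_on ({s. Re s > 0} - {1})"
      by (rule holomorphic_on_subset[OF r_seq_transform_holomorphic]) auto
    have "zeta holomorphic_on ({s. Re s > 0} - {1})"
      using is_zeta_continuation_zeta unfolding is_zeta_continuation_def
      by (auto elim: holomorphic_on_subset)
    then show "(\<lambda>s. zeta s * (1 - of_nat k powr (1 - s))) holomorphic_on ({s. Re s > 0} - {1})"
      by (intro holomorphic_intros)
    show "(\<Sum>n. of_real (r_seq k (Suc n)) * zeta_weight s (Suc n))
        = zeta s * (1 - of_nat k powr (1 - s))" if "s \<in> {s. Re s > 1}" for s
      using r_seq_transform_halfplane[OF _ k] that by (simp add: sums_iff)
  qed (use s in auto)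
  moreover have "summable (\<lambda>n. of_real (r_seq k (Suc n)) * zeta_weight s (Suc n))"
    by (rule bounded_zeta_weight_summable[where C = "real k"])
       (use s r_seq_bounds in auto)
  ultimately show ?thesis by (simp add: sums_iff)
qed

lemma zeta_weight_sums:
  assumes "Re s > 0"
  shows "(\<lambda>n. zeta_weight s (Suc n)) sums 1"
proof -
  have "(\<lambda>n. of_nat (Suc n) powr (- s)) \<longlonglongrightarrow> (0::complex)"
  proof (rule tendsto_norm_zero_cancel)
    have n: "norm ((of_nat (Suc n) :: complex) powr (- s)) = real (Suc n) powr (- Re s)" for n
      using norm_powr_real_powr[of "of_nat (Suc n)" "- s"] by (simp del: of_nat_Suc)
    have "((\<lambda>n. real n powr (- Re s)) \<longlongrightarrow> 0) sequentially"
      using assms by (intro tendsto_neg_powr filterlim_real_sequentially) auto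
    from LIMSEQ_Suc[OF this]
    show "(\<lambda>n. norm ((of_nat (Suc n) :: complex) powr (- s))) \<longlonglongrightarrow> 0"
      unfolding n .
  qed
  from telescope_sums'[OF this] show ?thesis
    by (simp add: zeta_weight_def)
qed

lemma F_seq_transform_at_zeta_zero:
  assumes s: "Re s > 0" "s \<noteq> 1" and zero: "zeta s = 0"
  shows "(\<lambda>n. of_real (F_seq m (Suc n)) * zeta_weight s (Suc n)) sums 1"
proof -
  have r: "(\<lambda>n. of_real (r_seq k (Suc n)) * zeta_weight s (Suc n)) sums 0" for k
  proof (cases "k = 0")
    (* r_seq 0 occurs in F_seq 0; it vanishes because of the factor k in its definition. *)
    case True
    then show ?thesis by (simp add: r_seq_def)
  next
    case False
    with r_seq_transform[OF s, of k] zero show ?thesis by simp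
  qed
  define c where "c k = complex_of_real (real_of_int (moebius k) / real k)" for k
  have "(\<lambda>n. zeta_weight s (Suc n)
        + (\<Sum>k = 2..m. c k * (of_real (r_seq k (Suc n)) * zeta_weight s (Suc n)))
        - (\<Sum>k = 1..m. c k) * (of_real (r_seq m (Suc n)) * zeta_weight s (Suc n)))
      sums (1 + (\<Sum>k = 2..m. c k * 0) - (\<Sum>k = 1..m. c k) * 0)"
    by (intro sums_add sums_diff sums_sum sums_mult r zeta_weight_sums s)
  moreover have "zeta_weight s (Suc n)
        + (\<Sum>k = 2..m. c k * (of_real (r_seq k (Suc n)) * zeta_weight s (Suc n)))
        - (\<Sum>k = 1..m. c k) * (of_real (r_seq m (Suc n)) * zeta_weight s (Suc n))
      = of_real (F_seq m (Suc n)) * zeta_weight s (Suc n)" for n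
    unfolding F_seq_def c_def
    by (simp add: algebra_simps sum_distrib_left sum_distrib_right)
  ultimately show ?thesis by simp
qed

text \<open>
  Continuity of the functional on the line \<open>Re s = 1\<close>, with constant \<open>norm s\<close>. If \<open>u\<close> is outside
  the weighted space, the right-hand side is infinite because \<open>s \<noteq> 0\<close>.
\<close>
lemma zeta_weight_sum_le_norm_1_m2:
  assumes s: "Re s = 1" and L: "(\<lambda>n. of_real (u (Suc n)) * zeta_weight s (Suc n)) sums L"
  shows "ennreal (norm L) \<le> ennreal (norm s) * norm_1_m2 u"
proof (cases "summable (\<lambda>n. \<bar>u (Suc n)\<bar> / real (Suc n) ^ 2)")
  case True
  have "norm L \<le> (\<Sum>n. norm s * (\<bar>u (Suc n)\<bar> / real (Suc n) ^ 2))"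
    unfolding sums_unique[OF L]
  proof (rule norm_suminf_le)
    fix n
    have "norm (zeta_weight s (Suc n)) \<le> norm s * real (Suc n) powr (- Re s - 1)"
      by (rule zeta_weight_bound) (use s in auto)
    also have "real (Suc n) powr (- Re s - 1) = 1 / real (Suc n) ^ 2"
    proof -
      have "real (Suc n) powr (- Re s - 1) = real (Suc n) powr (- 2)" using s by simp
      also have "\<dots> = 1 / real (Suc n) powr 2" by (simp only: powr_minus_divide)
      finally show ?thesis by (simp only: powr_numeral of_nat_0_le_iff)
    qed
    finally have "\<bar>u (Suc n)\<bar> * norm (zeta_weight s (Suc n))
        \<le> \<bar>u (Suc n)\<bar> * (norm s * (1 / real (Suc n) ^ 2))"
      by (rule mult_left_mono) simp
    then show "norm (of_real (u (Suc n)) * zeta_weight s (Suc n))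
        \<le> norm s * (\<bar>u (Suc n)\<bar> / real (Suc n) ^ 2)"
      by (simp add: norm_mult mult_ac)
  qed (rule summable_mult[OF True])
  also have "\<dots> = norm s * (\<Sum>n. \<bar>u (Suc n)\<bar> / real (Suc n) ^ 2)"
    by (rule suminf_mult[OF True])
  finally have "ennreal (norm L) \<le> ennreal (norm s * (\<Sum>n. \<bar>u (Suc n)\<bar> / real (Suc n) ^ 2))"
    by (rule ennreal_leI)
  also have "\<dots> = ennreal (norm s) * ennreal (\<Sum>n. \<bar>u (Suc n)\<bar> / real (Suc n) ^ 2)"
    by (intro ennreal_mult suminf_nonneg True) auto
  also have "ennreal (\<Sum>n. \<bar>u (Suc n)\<bar> / real (Suc n) ^ 2) = norm_1_m2 u"
    unfolding norm_1_m2_def by (rule suminf_ennreal2[symmetric]) (use True in auto)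
  finally show ?thesis .
next
  case False
  have "norm_1_m2 u = top"
    unfolding norm_1_m2_def
  proof (rule ccontr)
    assume "(\<Sum>n. ennreal (\<bar>u (Suc n)\<bar> / real (Suc n) ^ 2)) \<noteq> top"
    from summable_suminf_not_top[OF _ this] False show False by simp
  qed
  moreover have "norm s \<noteq> 0" using s by auto
  ultimately show ?thesis by (simp add: ennreal_mult_top)
qed

theorem corollary2p6:
  assumes "(\<lambda>m. norm_1_m2 (F_seq m)) \<longlonglongrightarrow> 0"
  shows "\<forall>s::complex. s \<noteq> 1 \<and> Re s = 1 \<longrightarrow> zeta s \<noteq> 0"
proof (intro allI impI notI)
  fix s :: complex
  assume s: "s \<noteq> 1 \<and> Re s = 1" and zero: "zeta s = 0"
  have "1 \<le> ennreal (norm s) * norm_1_m2 (F_seq m)" for m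
    using zeta_weight_sum_le_norm_1_m2[OF _ F_seq_transform_at_zeta_zero[of s m]] s zero by simp
  moreover have "(\<lambda>m. ennreal (norm s) * norm_1_m2 (F_seq m)) \<longlonglongrightarrow> ennreal (norm s) * 0"
    by (intro ennreal_tendsto_cmult assms) simp
  ultimately have "(1::ennreal) \<le> ennreal (norm s) * 0"
    by (intro LIMSEQ_le_const) auto
  then show False by simp
qed

end
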